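(* Let $X$ be a Banach space, let $M$ be a nonempty closed subset of the unit sphere of $X$ such that $\operatorname{cone}(M)$ is convex, and let $f\colon X\to\mathbb{R}$. Let $\bar x\in X$ be a global minimum point of $f$ with respect to $M$ on $D_{\bar x}$, and suppose that $f$ is subhomogeneous with respect to $\bar x$ on $D_{\bar x}$. Then the function $c_0\colon[0,\infty)\to[0,\infty)$ is admissible if and only if $\operatorname{diam}(\mathcal{L}(\bar x,\epsilon))\to 0$ as $\epsilon\to 0$.
   Context: $\operatorname{cone}(M)=\{\lambda u\mid \lambda\ge 0,\ u\in M\}$ and $\operatorname{diam}(C)=\sup\{\|x-y\|\mid x,y\in C\}$. The minimal time function with respect to $M$ is $T_M(y,x):=\inf\{t\ge 0\mid x\in y+tM\}\in[0,\infty]$, with $\inf\emptyset=\infty$. For $x\in X$, $D_x:=\{z\in X\mid T_M(z,x)<\infty\}$. The point $\bar x$ is a global minimum point of $f$ with respect to $M$ on $D_{\bar x}$ if $f(\bar x)\le f(x)$ for all $x\in D_{\bar x}$. The function $f$ is subhomogeneous with respect to $\bar x$ on $D_{\bar x}$ if for every $x\in D_{\bar x}$, $f(sx+(1-s)\bar x)\le sf(x)+(1-s)f(\bar x)$ for all $s\in[0,1]$. For $\epsilon>0$, $\mathcal{L}(\bar x,\epsilon):=\{y\in D_{\bar x}\mid f(y)\le\inf_{x\in D_{\bar x}}f(x)+\epsilon\}$. For $t\in[0,\infty)$, $c_0(t):=\inf\{f(x)-f(\bar x)\mid x\in D_{\bar x},\ T_M(x,\bar x)=t\}$ (under the assumptions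 the set is nonempty for every $t\ge 0$, so $c_0(t)\in[0,\infty)$). Admissible function: for a set $D\subset[0,\infty)$ with $0\in D$, a function $c\colon D\to[0,\infty)$ is admissible if (i) $c(0)=0$ and (ii) for every sequence $(t_k)\subset D$ with $c(t_k)\to 0$, one has $t_k\to 0$. *)

theory Defs
  imports "HOL-Analysis.Analysis"
begin

definition gen_cone :: "'a::real_vector set \<Rightarrow> 'a set" where
  "gen_cone M = {l *\<^sub>R u | l u. l \<ge> 0 \<and> u \<in> M}"

(* Extended-valued: the library's real-valued diameter takes an unspecified value on
   unbounded sets, and the sublevel sets considered here may be unbounded. *)
definition ediam :: "'a::real_normed_vector set \<Rightarrow> ennreal" where
  "ediam C = Sup {ennreal (norm (x - y)) | x y. x \<in> C \<and> y \<in> C}"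

definition min_time :: "'a::real_vector set \<Rightarrow> 'a \<Rightarrow> 'a \<Rightarrow> ennreal" where
  "min_time M y x = Inf {ennreal t | t. t \<ge> 0 \<and> x \<in> (\<lambda>u. y + t *\<^sub>R u) ` M}"

definition time_dom :: "'a::real_vector set \<Rightarrow> 'a \<Rightarrow> 'a set" where
  "time_dom M x = {z. min_time M z x < \<infinity>}"

definition dir_global_min :: "'a::real_vector set \<Rightarrow> ('a \<Rightarrow> real) \<Rightarrow> 'a \<Rightarrow> bool" where
  "dir_global_min M f xbar \<longleftrightarrow> (\<forall>x\<in>time_dom M xbar. f xbar \<le> f x)"

definition subhomogeneous :: "'a::real_vector set \<Rightarrow> ('a \<Rightarrow> real) \<Rightarrow> 'a \<Rightarrow> bool" where
  "subhomogeneous M f xbar \<longleftrightarrow>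
     (\<forall>x\<in>time_dom M xbar. \<forall>s\<in>{0..1}.
        f (s *\<^sub>R x + (1 - s) *\<^sub>R xbar) \<le> s * f x + (1 - s) * f xbar)"

(* The infimum is taken in the extended reals, so it is meaningful for every f. *)
definition approx_min :: "'a::real_vector set \<Rightarrow> ('a \<Rightarrow> real) \<Rightarrow> 'a \<Rightarrow> real \<Rightarrow> 'a set" where
  "approx_min M f xbar \<epsilon> =
     {y \<in> time_dom M xbar. ereal (f y) \<le> (INF x\<in>time_dom M xbar. ereal (f x)) + ereal \<epsilon>}"

(* Real infimum: meaningful for t >= 0 when M is a nonempty subset of the unit sphere and
   xbar is a directional global minimum, since the set is then nonempty and bounded
   below by 0. *)
definition c0 :: "'a::real_vector set \<Rightarrow> ('a \<Rightarrow> real) \<Rightarrow> 'a \<Rightarrow> real \<Rightarrow> real" where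
  "c0 M f xbar t = Inf {f x - f xbar | x. x \<in> time_dom M xbar \<and> min_time M x xbar = ennreal t}"

(* The first three conjuncts express that c is a function from D to [0,oo), where D is a
   subset of [0,oo) containing 0. *)
definition admissible_on :: "real set \<Rightarrow> (real \<Rightarrow> real) \<Rightarrow> bool" where
  "admissible_on D c \<longleftrightarrow>
     D \<subseteq> {0..} \<and> 0 \<in> D \<and> c \<in> D \<rightarrow> {0..} \<and>
     c 0 = 0 \<and>
     (\<forall>t :: nat \<Rightarrow> real. (\<forall>k. t k \<in> D) \<longrightarrow> (\<lambda>k. c (t k)) \<longlonglongrightarrow> 0 \<longrightarrow> t \<longlonglongrightarrow> 0)"

end

(* For unit directions the minimal time to reach xbar from a point of its time domain is the norm
   distance to xbar. Hence c0 M f xbar t is the least excess f x - f xbar at distance t from xbar,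
   and both properties say that a small excess forces a small distance to xbar. *)
theory Submission
  imports Defs
begin

text \<open>Trades the extended supremum for real pointwise bounds. The sign condition matters
  because \<open>ennreal\<close> sends negative reals to 0, the diameter of a singleton.\<close>

lemma ediam_le_iff:
  assumes "r \<ge> 0"
  shows "ediam C \<le> ennreal r \<longleftrightarrow> (\<forall>x\<in>C. \<forall>y\<in>C. norm (x - y) \<le> r)"
  using assms by (fastforce simp: ediam_def Sup_le_iff)

text \<open>The usual passage between sequences and quantifiers: if some \<open>e\<close> admits no
  \<open>d\<close>, choosing a bad point for each \<open>d = 1/(k+1)\<close> yields a sequence along
  which \<open>c\<close> tends to 0 while its terms stay at least \<open>e\<close>.\<close>

lemma admissible_on_iff:
  assumes "D \<subseteq> {0..}" "0 \<in> D" "\<And>t. t \<in> D \<Longrightarrow> c t \<ge> 0" "c 0 = 0"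
  shows "admissible_on D c \<longleftrightarrow> (\<forall>e>0. \<exists>d>0. \<forall>t\<in>D. c t < d \<longrightarrow> t < e)"
proof
  assume adm: "admissible_on D c"
  show "\<forall>e>0. \<exists>d>0. \<forall>t\<in>D. c t < d \<longrightarrow> t < e"
  proof (intro allI impI, rule ccontr)
    fix e :: real
    assume e: "e > 0" and "\<not> (\<exists>d>0. \<forall>t\<in>D. c t < d \<longrightarrow> t < e)"
    then have "\<exists>t\<in>D. c t < inverse (real (Suc k)) \<and> e \<le> t" for k
      by (metis inverse_positive_iff_positive not_less of_nat_0_less_iff zero_less_Suc)
    then obtain t where t: "\<And>k. t k \<in> D" "\<And>k. c (t k) < inverse (real (Suc k))" "\<And>k. e \<le> t k"
      by metis
    have "(\<lambda>k. c (t k)) \<longlonglongrightarrow> 0"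
    proof (rule tendsto_sandwich[OF _ _ tendsto_const LIMSEQ_inverse_real_of_nat])
      show "\<forall>\<^sub>F k in sequentially. 0 \<le> c (t k)"
        using assms(3) t(1) by simp
      show "\<forall>\<^sub>F k in sequentially. c (t k) \<le> inverse (real (Suc k))"
        using t(2) by (intro always_eventually allI less_imp_le)
    qed
    then have "t \<longlonglongrightarrow> 0"
      using adm t(1) by (auto simp: admissible_on_def)
    then have "e \<le> 0"
      by (rule LIMSEQ_le_const) (use t(3) in auto)
    then show False
      using e by simp
  qed
next
  assume *: "\<forall>e>0. \<exists>d>0. \<forall>t\<in>D. c t < d \<longrightarrow> t < e"
  have "t \<longlonglongrightarrow> 0" if t: "\<And>k. t k \<in> D" and lim: "(\<lambda>k. c (t k)) \<longlonglongrightarrow> 0" for t :: "nat \<Rightarrow> real"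
  proof (rule order_tendstoI)
    \<comment> \<open>The lower half of the convergence is free, since all terms are nonnegative;
      only the upper half uses the condition on \<open>c\<close>.\<close>
    fix a :: real
    assume "a < 0"
    then show "\<forall>\<^sub>F k in sequentially. a < t k"
      using t assms(1) by (intro always_eventually) (meson atLeast_iff less_le_trans subsetD)
  next
    fix e :: real
    assume "0 < e"
    then obtain d where d: "d > 0" "\<And>s. s \<in> D \<Longrightarrow> c s < d \<Longrightarrow> s < e"
      using * by meson
    show "\<forall>\<^sub>F k in sequentially. t k < e"
      using order_tendstoD(2)[OF lim d(1)] by eventually_elim (use d(2) t in blast)
  qed
  then show "admissible_on D c"
    using assms by (auto simp: admissible_on_def)
qed

text \<open>Since every direction has norm 1, \<open>x = z + t *\<^sub>R u\<close> forces
  \<open>t = norm (z - x)\<close>. So the set of feasible times has at most one element, and it is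
  empty exactly when \<open>z\<close> is not reached from \<open>x\<close> along a reversed
  direction.\<close>

lemma min_time_sphere:
  fixes M :: "'a::real_normed_vector set"
  assumes "M \<subseteq> sphere 0 1"
  shows "min_time M z x =
    (if z \<in> {x - s *\<^sub>R u | s u. s \<ge> 0 \<and> u \<in> M} then ennreal (norm (z - x)) else \<infinity>)"
proof -
  have unique: "t = norm (z - x)" if "t \<ge> 0" "u \<in> M" "x = z + t *\<^sub>R u" for t u
    using that assms by auto
  show ?thesis
  proof (cases "z \<in> {x - s *\<^sub>R u | s u. s \<ge> 0 \<and> u \<in> M}")
    case True
    then obtain s u where su: "s \<ge> 0" "u \<in> M" "x = z + s *\<^sub>R u"
      by force
    have "t \<ge> 0 \<and> x \<in> (\<lambda>u. z + t *\<^sub>R u) ` M \<longleftrightarrow> t = norm (z - x)" for t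
    proof
      assume "t \<ge> 0 \<and> x \<in> (\<lambda>u. z + t *\<^sub>R u) ` M"
      then show "t = norm (z - x)"
        using unique by blast
    next
      assume "t = norm (z - x)"
      then have "t = s"
        using unique[OF su] by simp
      then show "t \<ge> 0 \<and> x \<in> (\<lambda>u. z + t *\<^sub>R u) ` M"
        using su by blast
    qed
    then have "{ennreal t | t. t \<ge> 0 \<and> x \<in> (\<lambda>u. z + t *\<^sub>R u) ` M} = {ennreal (norm (z - x))}"
      by simp
    with True show ?thesis
      by (simp add: min_time_def)
  next
    case False
    then have none: "{ennreal t | t. t \<ge> 0 \<and> x \<in> (\<lambda>u. z + t *\<^sub>R u) ` M} = {}"
      by (auto simp: algebra_simps)
    from False show ?thesis
      unfolding min_time_def none by (simp only: if_False Inf_empty infinity_ennreal_def top_ennreal_def)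
  qed
qed

lemma time_dom_sphere:
  fixes M :: "'a::real_normed_vector set"
  assumes "M \<subseteq> sphere 0 1"
  shows "time_dom M x = {x - s *\<^sub>R u | s u. s \<ge> 0 \<and> u \<in> M}"
  by (auto simp: time_dom_def min_time_sphere[OF assms])

lemma min_time_eq_norm:
  fixes M :: "'a::real_normed_vector set"
  assumes "M \<subseteq> sphere 0 1" "z \<in> time_dom M x"
  shows "min_time M z x = ennreal (norm (z - x))"
  using assms by (simp add: min_time_sphere time_dom_sphere)

lemma center_in_time_dom:
  assumes "M \<noteq> {}"
  shows "x \<in> time_dom M x"
proof -
  have "min_time M x x \<le> ennreal 0"
    unfolding min_time_def using assms by (intro Inf_lower) auto
  then show ?thesis
    by (simp add: time_dom_def)
qed

text \<open>The infimum is attained at \<open>xbar\<close>, which belongs to its own time domain, so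
  it is the finite value \<open>f xbar\<close> and the extended inequality becomes a real
  one.\<close>

lemma approx_min_eq:
  assumes "M \<noteq> {}" "dir_global_min M f xbar"
  shows "approx_min M f xbar \<epsilon> = {y \<in> time_dom M xbar. f y \<le> f xbar + \<epsilon>}"
proof -
  have "(INF x\<in>time_dom M xbar. ereal (f x)) = ereal (f xbar)"
    using assms center_in_time_dom[OF assms(1)]
    by (intro antisym INF_lower INF_greatest) (auto simp: dir_global_min_def)
  then show ?thesis
    by (simp add: approx_min_def)
qed

text \<open>Replaces the constraint on the minimal time by one on the norm. For negative
  \<open>t\<close> this would fail, as \<open>ennreal t\<close> would be 0.\<close>

lemma c0_sphere:
  fixes M :: "'a::real_normed_vector set"
  assumes "M \<subseteq> sphere 0 1" "t \<ge> 0"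
  shows "c0 M f xbar t = (INF x\<in>{x \<in> time_dom M xbar. norm (x - xbar) = t}. f x - f xbar)"
proof -
  have "{x. x \<in> time_dom M xbar \<and> min_time M x xbar = ennreal t} =
      {x \<in> time_dom M xbar. norm (x - xbar) = t}"
    using assms by (auto simp: min_time_eq_norm)
  then show ?thesis
    by (simp add: c0_def setcompr_eq_image)
qed

lemma time_dom_norm_nonempty:
  fixes M :: "'a::real_normed_vector set"
  assumes "M \<noteq> {}" "M \<subseteq> sphere 0 1" "t \<ge> 0"
  shows "{x \<in> time_dom M xbar. norm (x - xbar) = t} \<noteq> {}"
proof -
  obtain u where "u \<in> M" "norm u = 1"
    using assms by (auto simp: subset_iff)
  \<comment> \<open>The minus sign appears because the motion starts at the witness and reaches
    \<open>xbar\<close> along \<open>u\<close>.\<close>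
  then have "xbar - t *\<^sub>R u \<in> {x \<in> time_dom M xbar. norm (x - xbar) = t}"
    using assms by (auto simp: time_dom_sphere)
  then show ?thesis
    by blast
qed

lemma excess_bdd_below:
  assumes "dir_global_min M f xbar"
  shows "bdd_below ((\<lambda>x. f x - f xbar) ` {x \<in> time_dom M xbar. P x})"
  using assms by (auto simp: dir_global_min_def intro!: bdd_belowI2[where m = 0])

text \<open>The infimum need not be attained, so it is the strict inequality that is equivalent to
  the existence of a point. This is why smallness of \<open>c0\<close> is expressed by
  \<open><\<close> throughout.\<close>

lemma c0_less_iff:
  fixes M :: "'a::real_normed_vector set"
  assumes "M \<noteq> {}" "M \<subseteq> sphere 0 1" "dir_global_min M f xbar" "t \<ge> 0"
  shows "c0 M f xbar t < d \<longleftrightarrow> (\<exists>x\<in>time_dom M xbar. norm (x - xbar) = t \<and> f x - f xbar < d)"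
  unfolding c0_sphere[OF assms(2,4)]
  by (subst cINF_less_iff[OF time_dom_norm_nonempty[OF assms(1,2,4)] excess_bdd_below[OF assms(3)]])
    auto

lemma c0_nonneg:
  fixes M :: "'a::real_normed_vector set"
  assumes "M \<noteq> {}" "M \<subseteq> sphere 0 1" "dir_global_min M f xbar" "t \<ge> 0"
  shows "c0 M f xbar t \<ge> 0"
  unfolding c0_sphere[OF assms(2,4)]
  using assms by (intro cINF_greatest time_dom_norm_nonempty) (auto simp: dir_global_min_def)

lemma c0_zero:
  fixes M :: "'a::real_normed_vector set"
  assumes "M \<noteq> {}" "M \<subseteq> sphere 0 1"
  shows "c0 M f xbar 0 = 0"
proof -
  have "{x \<in> time_dom M xbar. norm (x - xbar) = 0} = {xbar}"
    using center_in_time_dom[OF assms(1)] by auto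
  then show ?thesis
    using c0_sphere[OF assms(2), of 0] by simp
qed

theorem theorem5p2:
  fixes M :: "'a::banach set" and f :: "'a \<Rightarrow> real" and xbar :: 'a
  assumes "M \<noteq> {}" and "closed M" and "M \<subseteq> sphere 0 1"
    and "convex (gen_cone M)"
    and "dir_global_min M f xbar"
    and "subhomogeneous M f xbar"
  shows "admissible_on {0..} (c0 M f xbar) \<longleftrightarrow>
         ((\<lambda>\<epsilon>. ediam (approx_min M f xbar \<epsilon>)) \<longlongrightarrow> 0) (at_right 0)"
proof -
  let ?D = "time_dom M xbar"
  note approx = approx_min_eq[OF assms(1,5)]
  note center = center_in_time_dom[OF assms(1), of xbar]
  have "admissible_on {0..} (c0 M f xbar) \<longleftrightarrow>
      (\<forall>e>0. \<exists>d>0. \<forall>t\<in>{0..}. c0 M f xbar t < d \<longrightarrow> t < e)"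
    using c0_nonneg[OF assms(1,3,5)] c0_zero[OF assms(1,3)] by (intro admissible_on_iff) auto
  also have "\<dots> \<longleftrightarrow> (\<forall>e>0. \<exists>d>0. \<forall>x\<in>?D. f x - f xbar < d \<longrightarrow> norm (x - xbar) < e)"
  proof -
    \<comment> \<open>The same \<open>d\<close> and \<open>e\<close> serve both sides: unfolding the
      infimum leaves a quantifier over \<open>t\<close> and over points at distance
      \<open>t\<close>, and \<open>t\<close> is then eliminated as
      \<open>norm (x - xbar)\<close>.\<close>
    have "(\<forall>t\<in>{0..}. c0 M f xbar t < d \<longrightarrow> t < e) \<longleftrightarrow>
        (\<forall>x\<in>?D. f x - f xbar < d \<longrightarrow> norm (x - xbar) < e)" for d e
      using c0_less_iff[OF assms(1,3,5)] by auto
    then show ?thesis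
      by simp
  qed
  also have "\<dots> \<longleftrightarrow> ((\<lambda>\<epsilon>. ediam (approx_min M f xbar \<epsilon>)) \<longlongrightarrow> 0) (at_right 0)"
  proof
    assume *: "\<forall>e>0. \<exists>d>0. \<forall>x\<in>?D. f x - f xbar < d \<longrightarrow> norm (x - xbar) < e"
    show "((\<lambda>\<epsilon>. ediam (approx_min M f xbar \<epsilon>)) \<longlongrightarrow> 0) (at_right 0)"
    proof (rule order_tendstoI)
      fix a :: ennreal
      assume "0 < a"
      \<comment> \<open>As \<open>a\<close> may be infinite, a smaller \<open>b\<close> supplies a
        real radius \<open>r\<close>. The gap between \<open>b\<close> and \<open>a\<close> also
        makes the non-strict bound on the diameter strict.\<close>
      then obtain b where b: "0 < b" "b < a"
        using dense by blast
      then obtain r where r: "b = ennreal r" "0 < r"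
        by (cases b) auto
      \<comment> \<open>Half of \<open>r\<close>, because two points of the sublevel set are
        compared through \<open>xbar\<close>.\<close>
      with * obtain d where d: "d > 0" "\<And>x. x \<in> ?D \<Longrightarrow> f x - f xbar < d \<Longrightarrow> norm (x - xbar) < r / 2"
        by (meson half_gt_zero)
      have "\<forall>\<^sub>F \<epsilon> in at_right 0. \<epsilon> < d"
        using d(1) eventually_at_right_less[of 0] by (auto simp: eventually_at_right_field)
      then show "\<forall>\<^sub>F \<epsilon> in at_right 0. ediam (approx_min M f xbar \<epsilon>) < a"
      proof eventually_elim
        case (elim \<epsilon>)
        have near: "norm (x - xbar) < r / 2" if "x \<in> approx_min M f xbar \<epsilon>" for x
          using that elim d(2)[of x] by (auto simp: approx)
        have "norm (x - y) \<le> r" if "x \<in> approx_min M f xbar \<epsilon>" "y \<in> approx_min M f xbar \<epsilon>" for x y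
          using near[OF that(1)] near[OF that(2)] norm_triangle_ineq4[of "x - xbar" "y - xbar"]
          by simp
        then show ?case
          using ediam_le_iff[of r] r b by (metis le_less_trans less_imp_le)
      qed
    qed simp
  next
    assume lim: "((\<lambda>\<epsilon>. ediam (approx_min M f xbar \<epsilon>)) \<longlongrightarrow> 0) (at_right 0)"
    show "\<forall>e>0. \<exists>d>0. \<forall>x\<in>?D. f x - f xbar < d \<longrightarrow> norm (x - xbar) < e"
    proof (intro allI impI)
      fix e :: real
      assume e: "e > 0"
      then have "\<forall>\<^sub>F \<epsilon> in at_right 0. ediam (approx_min M f xbar \<epsilon>) < ennreal (e / 2)"
        by (intro order_tendstoD(2)[OF lim]) simp
      \<comment> \<open>Positivity is carried along so that the \<open>\<epsilon>\<close> picked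
        below can serve as \<open>d\<close>.\<close>
      then have "\<forall>\<^sub>F \<epsilon> in at_right 0. ediam (approx_min M f xbar \<epsilon>) < ennreal (e / 2) \<and> 0 < \<epsilon>"
        by (intro eventually_conj eventually_at_right_less)
      then obtain d where d: "ediam (approx_min M f xbar d) < ennreal (e / 2)" "0 < d"
        using eventually_happens' trivial_limit_at_right_real by blast
      \<comment> \<open>Both \<open>x\<close> and \<open>xbar\<close> lie in the sublevel set for
        \<open>d\<close>, the latter because \<open>d > 0\<close>, so their distance is at most its
        diameter. Using \<open>e / 2\<close> leaves room for the strict inequality.\<close>
      have "norm (x - xbar) < e" if "x \<in> ?D" "f x - f xbar < d" for x
        using ediam_le_iff[of "e / 2" "approx_min M f xbar d"] d e that center
        by (fastforce simp: approx)
      with d(2) show "\<exists>d>0. \<forall>x\<in>?D. f x - f xbar < d \<longrightarrow> norm (x - xbar) < e"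
        by blast
    qed
  qed
  finally show ?thesis .
qed

end
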